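(* Let $P_X,P_Y$ be distributions on $\mathbb{R}^d$ such that, for $X\sim P_X$, $Y\sim P_Y$, $\beta^\top X$ and $\beta^\top Y$ have continuous distribution functions for $\lambda$-almost all $\beta\in\mathbb{S}^{d-1}$. Let $X_1,X_2$ be i.i.d. from $P_X$ and, independently, $Y_1,Y_2$ i.i.d. from $P_Y$. Then $$2W_d^2(P_X,P_Y)=2\,\mathbb{E}[\rho_{Angle}(X_1,Y_1)]-\mathbb{E}[\rho_{Angle}(X_1,X_2)]-\mathbb{E}[\rho_{Angle}(Y_1,Y_2)].$$
   Context: $\lambda$ is the uniform probability measure on the unit sphere $\mathbb{S}^{d-1}$. Angular distance: for nonzero $U_1,U_2$ let $\mathsf{Ang}(U_1,U_2)=\arccos\{U_1^\top U_2/(\|U_1\|\|U_2\|)\}$; let $Z^\ast$ be a random vector with the mixture distribution $\frac12P_X+\frac12P_Y$. For $z,z'$ in the union of the supports of $P_X$ and $P_Y$, $$\rho_{Angle}(z,z')=\mathbb{E}\Big[\frac1\pi\mathsf{Ang}(z-Z^\ast,z'-Z^\ast)\Big]$$ (expectation over $Z^\ast$ only; $Z^\ast$ is independent of the $X_i,Y_i$). The squared multivariate CvM-distance is $$W_d^2(P_X,P_Y)=\int_{\mathbb{S}^{d-1}}\int_{\mathbb{R}}\big(F_{\beta^\top X}(t)-F_{\beta^\top Y}(t)\big)^2\,d\{\vartheta_XF_{\beta^\top X}(t)+\vartheta_YF_{\beta^\top Y}(t)\}\,d\lambda(\beta),$$ where $F_{\beta^\top X},F_{\beta^\top Y}$ are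 the distribution functions of $\beta^\top X,\beta^\top Y$, $\vartheta_X\in(0,1)$ is fixed and $\vartheta_Y=1-\vartheta_X$. *)

theory Defs
  imports "HOL-Probability.Probability"
begin

section \<open>The uniform distribution on the unit sphere\<close>

text \<open>
  The normalised cone measure: a set \<open>A\<close> of directions gets the proportion of the volume of the
  unit ball that lies in the cone over \<open>A\<close>. This is normalised surface measure on the sphere
  (for \<open>d = 1\<close> it gives weight 1/2 to each of the two points). Note that \<open>sgn x = x /\<^sub>R norm x\<close>;
  the point \<open>sgn 0 = 0\<close> outside the sphere has mass zero before the restriction.
\<close>

definition uniform_sphere :: "(real ^ 'n) measure" where
  "uniform_sphere =
     restrict_space (distr (uniform_measure lborel (ball 0 1)) borel sgn) (sphere 0 1)"

lemma space_uniform_sphere: "space uniform_sphere = sphere 0 1"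
  by (simp add: uniform_sphere_def space_restrict_space)

lemma borel_measurable_sgn_vec [measurable]: "sgn \<in> borel_measurable (borel :: (real ^ 'n) measure)"
  unfolding sgn_div_norm[abs_def] by measurable

lemma prob_space_uniform_ball: "prob_space (uniform_measure lborel (ball (0 :: real ^ 'n) 1))"
proof (rule prob_space_uniform_measure)
  show "emeasure lborel (ball (0 :: real ^ 'n) 1) \<noteq> 0"
    by (metis content_ball_pos emeasure_lborel_ball_finite less_irrefl measure_def
        enn2real_0 zero_less_one)
  show "emeasure lborel (ball (0 :: real ^ 'n) 1) \<noteq> \<infinity>"
    using emeasure_lborel_ball_finite[of "0 :: real ^ 'n" 1] by simp
qed

lemma emeasure_uniform_sphere:
  fixes A :: "(real ^ 'n) set"
  assumes "A \<in> sets borel" "A \<subseteq> sphere 0 1"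
  shows "emeasure uniform_sphere A =
           emeasure lborel (ball 0 1 \<inter> sgn -` A) / emeasure lborel (ball (0 :: real ^ 'n) 1)"
proof -
  have "sgn -` A \<in> sets (borel :: (real ^ 'n) measure)"
    using measurable_sets[OF borel_measurable_sgn_vec assms(1)] by simp
  then show ?thesis
    using assms
    by (simp add: uniform_sphere_def emeasure_restrict_space emeasure_distr
        borel_measurable_sgn_vec uniform_measure_def[symmetric])
qed

lemma prob_space_uniform_sphere: "prob_space (uniform_sphere :: (real ^ 'n) measure)"
proof
  let ?B = "ball (0 :: real ^ 'n) 1"
  have "AE x in lborel. x \<noteq> (0 :: real ^ 'n)"
    by (rule AE_lborel_singleton)
  then have "emeasure lborel (?B \<inter> sgn -` sphere 0 1) = emeasure lborel ?B"
  proof (intro emeasure_eq_AE)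
    show "?B \<inter> sgn -` sphere 0 1 \<in> sets lborel"
      using measurable_sets[OF borel_measurable_sgn_vec, of "sphere 0 1 :: (real ^ 'n) set"]
      by simp
  qed (auto simp: norm_sgn elim!: eventually_mono)
  moreover have "emeasure lborel ?B / emeasure lborel ?B = 1"
    using prob_space.emeasure_space_1[OF prob_space_uniform_ball]
    by (simp add: emeasure_uniform_measure)
  ultimately show "emeasure uniform_sphere (space (uniform_sphere :: (real ^ 'n) measure)) = 1"
    by (simp add: space_uniform_sphere emeasure_uniform_sphere)
qed

lemma nn_integral_lborel_translate:
  fixes g :: "'a::euclidean_space \<Rightarrow> ennreal"
  assumes "g \<in> borel_measurable borel"
  shows "(\<integral>\<^sup>+x. g (c + x) \<partial>lborel) = (\<integral>\<^sup>+x. g x \<partial>lborel)"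
proof -
  have "(\<integral>\<^sup>+x. g x \<partial>lborel) = (\<integral>\<^sup>+x. g x \<partial>distr lborel borel ((+) c))"
    by (simp add: lborel_distr_plus)
  also have "\<dots> = (\<integral>\<^sup>+x. g (c + x) \<partial>lborel)"
    using assms by (intro nn_integral_distr) simp_all
  finally show ?thesis by simp
qed

text \<open>
  The change of variables theorem of the library gives this only for index types that are
  well-ordered, hence the direct argument: compute the integral over \<open>x\<close> and \<open>y\<close> of
  \<open>indicator A (f x + y) * indicator B y\<close> in two ways, for \<open>B\<close> the unit ball.
\<close>

lemma distr_lborel_orthogonal:
  fixes f :: "'a::euclidean_space \<Rightarrow> 'a"
  assumes f: "orthogonal_transformation f"
  shows "distr lborel borel f = lborel"
proof (rule measure_eqI)
  have lf: "linear f"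
    using f by (rule orthogonal_transformation_linear)
  have m[measurable]: "f \<in> borel_measurable borel"
    by (intro borel_measurable_continuous_onI linear_continuous_on
        linear_conv_bounded_linear[THEN iffD1] lf)
  define g where "g = inv f"
  have fg: "f (g y) = y" for y
    unfolding g_def by (simp add: f orthogonal_transformation_surj surj_f_inv_f)
  have nf: "norm (f x) = norm x" for x
    using f by (simp add: orthogonal_transformation_norm)
  fix A :: "'a set"
  assume "A \<in> sets (distr lborel borel f)"
  then have A[measurable]: "A \<in> sets borel"
    by simp
  define B where "B = ball (0::'a) 1"
  have B[measurable]: "B \<in> sets borel"
    by (simp add: B_def)
  have "B \<noteq> {}" "open B"
    by (auto simp: B_def)
  have inB: "indicator B (y - f x) = (indicator B (- g y + x) :: ennreal)" for x y
  proof -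
    have "norm (y - f x) = norm (f (g y - x))"
      using linear_diff[OF lf, of "g y" x] by (simp add: fg)
    also have "\<dots> = norm (- g y + x)"
      by (simp add: nf norm_minus_commute)
    finally show ?thesis
      by (simp add: B_def indicator_def)
  qed
  have "emeasure lborel (f -` A) * emeasure lborel B =
      (\<integral>\<^sup>+y. (\<integral>\<^sup>+x. indicator A (f x) \<partial>lborel) * indicator B y \<partial>lborel)"
  proof -
    have "(\<integral>\<^sup>+x. indicator A (f x) \<partial>lborel) = (\<integral>\<^sup>+x. indicator (f -` A) x \<partial>lborel)"
      by (intro nn_integral_cong) (simp add: indicator_def)
    also have "\<dots> = emeasure lborel (f -` A)"
      using measurable_sets[OF m A] by simp
    finally show ?thesis
      by (simp add: nn_integral_cmult_indicator)
  qed
  also have "\<dots> = (\<integral>\<^sup>+y. (\<integral>\<^sup>+x. indicator A (f x + y) \<partial>lborel) * indicator B y \<partial>lborel)"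
  proof (rule nn_integral_cong)
    fix y
    have "(\<integral>\<^sup>+x. indicator A (f (g y + x)) \<partial>lborel) = (\<integral>\<^sup>+x. indicator A (f x) \<partial>lborel)"
      by (rule nn_integral_lborel_translate) measurable
    moreover have "f (g y + x) = f x + y" for x
      using linear_add[OF lf, of "g y" x] by (simp add: fg)
    ultimately show "(\<integral>\<^sup>+x. indicator A (f x) \<partial>lborel) * indicator B y =
        (\<integral>\<^sup>+x. indicator A (f x + y) \<partial>lborel) * indicator B y"
      by simp
  qed
  also have "\<dots> = (\<integral>\<^sup>+y. \<integral>\<^sup>+x. indicator A (f x + y) * indicator B y \<partial>lborel \<partial>lborel)"
    by (intro nn_integral_cong nn_integral_multc[symmetric]) simp
  also have "\<dots> = (\<integral>\<^sup>+x. \<integral>\<^sup>+y. indicator A (f x + y) * indicator B y \<partial>lborel \<partial>lborel)"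
    by (rule lborel_pair.Fubini') simp
  also have "\<dots> = (\<integral>\<^sup>+x. \<integral>\<^sup>+y. indicator A y * indicator B (y - f x) \<partial>lborel \<partial>lborel)"
  proof (rule nn_integral_cong)
    fix x
    show "(\<integral>\<^sup>+y. indicator A (f x + y) * indicator B y \<partial>lborel) =
        (\<integral>\<^sup>+y. indicator A y * (indicator B (y - f x) :: ennreal) \<partial>lborel)"
      using nn_integral_lborel_translate[of "\<lambda>y. indicator A y * indicator B (y - f x)" "f x"]
      by simp
  qed
  also have "\<dots> = (\<integral>\<^sup>+y. \<integral>\<^sup>+x. indicator A y * indicator B (y - f x) \<partial>lborel \<partial>lborel)"
    by (rule lborel_pair.Fubini') simp
  also have "\<dots> = (\<integral>\<^sup>+y. emeasure lborel B * indicator A y \<partial>lborel)"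
  proof (rule nn_integral_cong)
    fix y
    have "(\<integral>\<^sup>+x. indicator B (- g y + x) \<partial>lborel) = emeasure lborel B"
      by (subst nn_integral_lborel_translate) auto
    then show "(\<integral>\<^sup>+x. indicator A y * indicator B (y - f x) \<partial>lborel) =
        emeasure lborel B * indicator A y"
      by (subst nn_integral_cmult) (simp_all add: inB mult.commute)
  qed
  also have "\<dots> = emeasure lborel B * emeasure lborel A"
    by (simp add: nn_integral_cmult_indicator)
  also have "\<dots> = emeasure lborel A * emeasure lborel B"
    by (rule mult.commute)
  finally have "emeasure lborel (f -` A) * emeasure lborel B = emeasure lborel A * emeasure lborel B" .
  moreover have "emeasure lborel B \<noteq> 0" "emeasure lborel B \<noteq> \<infinity>"
    using emeasure_lborel_ball_finite[of "0::'a" 1] \<open>B \<noteq> {}\<close> \<open>open B\<close>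
    by (auto simp: B_def emeasure_ball unit_ball_vol_pos[THEN less_imp_neq, symmetric])
  ultimately have "emeasure lborel (f -` A) = emeasure lborel A"
    by (metis ennreal_mult_divide_eq infinity_ennreal_def)
  then show "emeasure (distr lborel borel f) A = emeasure lborel A"
    by (simp add: emeasure_distr)
qed simp

lemma uniform_sphere_rotation_invariant:
  fixes f :: "real ^ 'n \<Rightarrow> real ^ 'n"
  assumes f: "orthogonal_transformation f"
  shows "distr uniform_sphere uniform_sphere f = uniform_sphere"
proof (rule measure_eqI)
  fix A
  assume "A \<in> sets (distr uniform_sphere uniform_sphere f)"
  then have A: "A \<in> sets borel" "A \<subseteq> sphere 0 1" "A \<in> sets uniform_sphere"
    by (auto simp: uniform_sphere_def sets_restrict_space)
  have m: "f \<in> borel_measurable borel"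
    using f by (intro borel_measurable_continuous_onI linear_continuous_on
        linear_conv_bounded_linear[THEN iffD1] orthogonal_transformation_linear)
  have nf: "norm (f x) = norm x" for x
    using f by (simp add: orthogonal_transformation_norm)
  have fs: "f (sgn x) = sgn (f x)" for x
    using f by (simp add: sgn_div_norm nf linear_scale orthogonal_transformation_linear)
  have mf: "f \<in> uniform_sphere \<rightarrow>\<^sub>M uniform_sphere"
    unfolding uniform_sphere_def using m
    by (intro measurable_restrict_space3) (auto simp: nf)
  have vA: "f -` A \<in> sets borel" "f -` A \<subseteq> sphere 0 1"
    using measurable_sets[OF m A(1)] A(2) nf by auto
  have sA: "ball 0 1 \<inter> sgn -` A \<in> sets borel"
    using measurable_sets[OF borel_measurable_sgn_vec A(1)] by auto
  have "ball 0 1 \<inter> sgn -` (f -` A) = f -` (ball 0 1 \<inter> sgn -` A)"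
    by (auto simp: nf fs)
  moreover have "emeasure lborel (f -` (ball 0 1 \<inter> sgn -` A)) = emeasure lborel (ball 0 1 \<inter> sgn -` A)"
    using emeasure_distr[of f lborel borel "ball 0 1 \<inter> sgn -` A"] m sA
      distr_lborel_orthogonal[OF f] by simp
  moreover have "f -` A \<inter> space uniform_sphere = f -` A"
    using vA by (auto simp: space_uniform_sphere)
  ultimately show "emeasure (distr uniform_sphere uniform_sphere f) A = emeasure uniform_sphere A"
    using A vA by (simp add: emeasure_distr[OF mf] emeasure_uniform_sphere)
qed simp


section \<open>The multivariate Cramer-von Mises distance\<close>

text \<open>The distribution function of \<open>\<beta>\<^sup>T X\<close> for \<open>X \<sim> P\<close>.\<close>

definition proj_cdf :: "(real ^ 'n) measure \<Rightarrow> real ^ 'n \<Rightarrow> real \<Rightarrow> real" where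
  "proj_cdf P \<beta> = cdf (distr P borel (\<lambda>x. \<beta> \<bullet> x))"

text \<open>
  The inner integral is the Lebesgue-Stieltjes integral with respect to the weighted average of the
  two distribution functions, with weight \<open>\<theta>\<close> on the first one.
\<close>

definition cvm_dist_sq :: "real \<Rightarrow> (real ^ 'n) measure \<Rightarrow> (real ^ 'n) measure \<Rightarrow> real" where
  "cvm_dist_sq \<theta> P Q =
     (LINT \<beta>|uniform_sphere.
        LINT t|interval_measure (\<lambda>s. \<theta> * proj_cdf P \<beta> s + (1 - \<theta>) * proj_cdf Q \<beta> s).
          (proj_cdf P \<beta> t - proj_cdf Q \<beta> t)\<^sup>2)"


section \<open>The angular distance\<close>

text \<open>
  Only meaningful for nonzero arguments; if \<open>u = 0\<close> or \<open>v = 0\<close>, division by zero makes the value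
  \<open>arccos 0 = pi / 2\<close>.
\<close>

definition ang :: "real ^ 'n \<Rightarrow> real ^ 'n \<Rightarrow> real" where
  "ang u v = arccos ((u \<bullet> v) / (norm u * norm v))"

definition half_mixture :: "'a measure \<Rightarrow> 'a measure \<Rightarrow> 'a measure" where
  "half_mixture P Q =
     measure_of (space P) (sets P) (\<lambda>A. (1/2) * emeasure P A + (1/2) * emeasure Q A)"

lemma space_half_mixture: "space (half_mixture P Q) = space P"
  by (simp add: half_mixture_def)

lemma sets_half_mixture [measurable_cong]: "sets (half_mixture P Q) = sets P"
  by (simp add: half_mixture_def)

lemma emeasure_half_mixture:
  assumes "sets Q = sets P" "A \<in> sets P"
  shows "emeasure (half_mixture P Q) A = (1/2) * emeasure P A + (1/2) * emeasure Q A"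
proof (rule emeasure_measure_of[OF half_mixture_def])
  show "countably_additive (sets (half_mixture P Q)) (\<lambda>A. (1/2) * emeasure P A + (1/2) * emeasure Q A)"
    using assms(1)
    by (auto simp: countably_additive_def suminf_add[symmetric] ennreal_suminf_cmult
        suminf_emeasure sets_half_mixture)
qed (use assms sets.space_closed in \<open>auto simp: positive_def sets_half_mixture\<close>)

text \<open>
  The expectation is over \<open>Z\<^sup>* \<sim> P/2 + Q/2\<close> only, the points \<open>z\<close> and \<open>z'\<close> being fixed.
\<close>

definition rho_angle ::
  "(real ^ 'n) measure \<Rightarrow> (real ^ 'n) measure \<Rightarrow> real ^ 'n \<Rightarrow> real ^ 'n \<Rightarrow> real" where
  "rho_angle P Q z z' = (LINT w|half_mixture P Q. (1 / pi) * ang (z - w) (z' - w))"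

end

theory Submission
  imports Defs
begin

text \<open>
  A uniformly distributed direction \<open>\<beta>\<close> separates nonzero vectors \<open>u\<close> and \<open>v\<close>, in the sense that
  exactly one of \<open>\<beta> \<bullet> u \<le> 0\<close> and \<open>\<beta> \<bullet> v \<le> 0\<close> holds, with probability \<open>ang u v / pi\<close>: within a plane
  this probability is rotation invariant, hence an additive function of the angle, and it is
  \<open>1\<close> for the angle \<open>pi\<close>. By Fubini, the expectation of \<open>\<rho>\<close> at independent points with laws
  \<open>A\<close> and \<open>B\<close> is therefore the average of \<open>F\<^sub>A + F\<^sub>B - 2 F\<^sub>A F\<^sub>B\<close> at \<open>\<beta> \<bullet> Z\<close> over \<open>\<beta>\<close> and
  \<open>Z \<sim> P/2 + Q/2\<close>, and
  \<open>2 (F + G - 2 F G) - (2 F - 2 F\<^sup>2) - (2 G - 2 G\<^sup>2) = 2 (F - G)\<^sup>2\<close>.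
  The weight \<open>\<theta>\<close> plays no role, since \<open>\<integral> (F - G)\<^sup>2 dF = \<integral> (F - G)\<^sup>2 dG\<close> for continuous
  distribution functions.
\<close>

section \<open>The angle as a separation probability\<close>

text \<open>Nonnegativity makes an additive \<open>f\<close> monotone, so \<open>f a\<close> is
  trapped between its values at neighbouring multiples of \<open>c / n\<close>, where additivity
  determines it; then \<open>n\<close> tends to infinity.\<close>

lemma additive_nonneg_imp_linear:
  fixes f :: "real \<Rightarrow> real"
  assumes c: "0 < c" and nonneg: "\<And>x. 0 \<le> x \<Longrightarrow> x \<le> c \<Longrightarrow> 0 \<le> f x"
    and add: "\<And>x y. 0 \<le> x \<Longrightarrow> 0 \<le> y \<Longrightarrow> x + y \<le> c \<Longrightarrow> f (x + y) = f x + f y"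
    and a: "0 \<le> a" "a \<le> c"
  shows "f a = a / c * f c"
proof -
  have f0: "f 0 = 0"
    using add[of 0 0] c by simp
  have mult: "f (real k * x) = real k * f x" if "0 \<le> x" "real k * x \<le> c" for k x
    using that(2)
  proof (induction k)
    case (Suc k)
    have "real k * x + x \<le> c"
      using Suc.prems by (simp add: algebra_simps)
    with Suc that(1) show ?case
      using add[of "real k * x" x] by (simp add: algebra_simps)
  qed (simp add: f0)
  have bound: "\<bar>f a - a / c * f c\<bar> \<le> f c / real n" if n: "n > 0" for n
  proof -
    \<comment> \<open>\<open>k\<close> is the number of full steps of length
      \<open>d = c / n\<close> that fit into \<open>a\<close>, and \<open>r < d\<close> is the
      remainder.\<close>
    define k where "k = nat \<lfloor>real n * a / c\<rfloor>"
    define d where "d = c / real n"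
    define r where "r = a - real k * d"
    have d: "d > 0" "real n * d = c"
      using n c by (auto simp: d_def)
    have q: "0 \<le> real n * a / c"
      using a c n by simp
    have "real k \<le> real n * a / c" "real n * a / c < real k + 1"
      using q unfolding k_def by linarith+
    then have kd: "real k * d \<le> a" "a < real k * d + d"
      using n c by (simp_all add: d_def field_simps)
    then have r: "0 \<le> r" "r < d"
      by (auto simp: r_def)
    have dc: "d \<le> c"
      using n c by (simp add: d_def field_simps)
    have fd: "f c = real n * f d"
      using mult[of d n] d by simp
    have "f a = f (real k * d) + f r"
      using add[of "real k * d" r] r d a by (simp add: r_def)
    also have "f (real k * d) = real k * f d"
      using mult[of d k] d kd a by simp
    finally have fa: "f a = real k * f d + f r" .
    have "f d = f r + f (d - r)"
      using add[of r "d - r"] r dc by simp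
    then have fr: "0 \<le> f r" "f r \<le> f d" "0 \<le> f d"
      using nonneg[of r] nonneg[of "d - r"] r dc by auto
    have "a / c * f c = a / d * f d"
      using d n c by (simp add: fd d_def)
    also have "a / d = real k + r / d"
      using d by (simp add: r_def field_simps)
    \<comment> \<open>Both \<open>f r\<close> and \<open>r / d * f d\<close> lie between 0 and
      \<open>f d = f c / n\<close>, which bounds the error.\<close>
    finally have e: "f a - a / c * f c = f r - r / d * f d"
      using fa by (simp add: algebra_simps)
    have "r / d \<le> 1"
      using r d by simp
    then have "0 \<le> r / d * f d" "r / d * f d \<le> 1 * f d"
      using r d fr by (simp, intro mult_right_mono)
    then have "\<bar>f a - a / c * f c\<bar> \<le> f d"
      unfolding e using fr by linarith
    then show ?thesis
      using fd n by simp
  qed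
  have "(\<lambda>n. f c / real n) \<longlonglongrightarrow> 0"
    by (rule lim_const_over_n)
  then have "\<bar>f a - a / c * f c\<bar> \<le> 0"
    by (rule tendsto_lowerbound) (rule eventually_sequentiallyI[of 1], rule bound, auto)
  then show ?thesis
    by simp
qed

section \<open>Plane rotations and random directions\<close>

text \<open>\<open>R t\<close> is the rotation by \<open>t\<close> in the plane of \<open>e1\<close>
  and \<open>e2\<close> and the identity on the orthogonal complement; the added terms are rotation
  minus identity, applied to the two plane coordinates.\<close>

lemma orthogonal_transformation_plane_rotation:
  fixes e1 e2 :: "'a::euclidean_space"
  assumes e: "e1 \<bullet> e1 = 1" "e2 \<bullet> e2 = 1" "e1 \<bullet> e2 = 0"
  defines "R \<equiv> \<lambda>t x. x + ((cos t - 1) * (x \<bullet> e1) - sin t * (x \<bullet> e2)) *\<^sub>R e1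
                  + (sin t * (x \<bullet> e1) + (cos t - 1) * (x \<bullet> e2)) *\<^sub>R e2"
  shows "orthogonal_transformation (R t)"
    and "R t (cos s *\<^sub>R e1 + sin s *\<^sub>R e2) = cos (s + t) *\<^sub>R e1 + sin (s + t) *\<^sub>R e2"
proof -
  have e': "e2 \<bullet> e1 = 0"
    using e by (simp add: inner_commute)
  have lin: "linear (R t)"
    unfolding R_def by (rule linearI) (simp_all add: inner_add_left algebra_simps)
  have "R t v \<bullet> R t w = v \<bullet> w" for v w
  proof -
    define A where "A x = (cos t - 1) * (x \<bullet> e1) - sin t * (x \<bullet> e2)" for x
    define B where "B x = sin t * (x \<bullet> e1) + (cos t - 1) * (x \<bullet> e2)" for x
    have "R t v \<bullet> R t w = v \<bullet> w + (A w * (v \<bullet> e1) + B w * (v \<bullet> e2) + A v * (w \<bullet> e1) + B v * (w \<bullet> e2)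
        + A v * A w + B v * B w)"
      unfolding R_def A_def[symmetric] B_def[symmetric]
      by (simp add: inner_add_left inner_add_right e e' inner_commute[of e1 w] inner_commute[of e2 w]
          distrib_left)
    also have "A w * (v \<bullet> e1) + B w * (v \<bullet> e2) + A v * (w \<bullet> e1) + B v * (w \<bullet> e2)
        + A v * A w + B v * B w =
        ((sin t)\<^sup>2 + (cos t)\<^sup>2 - 1) * ((v \<bullet> e1) * (w \<bullet> e1) + (v \<bullet> e2) * (w \<bullet> e2))"
      unfolding A_def B_def by algebra
    finally show ?thesis
      by simp
  qed
  with lin show "orthogonal_transformation (R t)"
    by (simp add: orthogonal_transformation_def)
  show "R t (cos s *\<^sub>R e1 + sin s *\<^sub>R e2) = cos (s + t) *\<^sub>R e1 + sin (s + t) *\<^sub>R e2"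
    unfolding R_def
    by (simp add: inner_add_left e e' cos_add sin_add algebra_simps)
qed

text \<open>The uniform distribution on the sphere as a measure on all Borel sets of the ambient space; this
  keeps the integrands below in reach of Borel measurability.\<close>

definition direction_measure :: "(real ^ 'n) measure" where
  "direction_measure = distr uniform_sphere borel (\<lambda>x. x)"

lemma measurable_uniform_sphere_ident: "(\<lambda>x. x) \<in> uniform_sphere \<rightarrow>\<^sub>M borel"
  by (simp add: uniform_sphere_def measurable_restrict_space1)

lemma sets_direction_measure [measurable_cong, simp]: "sets direction_measure = sets borel"
  and space_direction_measure [simp]: "space direction_measure = UNIV"
  by (simp_all add: direction_measure_def)

lemma prob_space_direction_measure: "prob_space direction_measure"
  unfolding direction_measure_def
  by (rule prob_space.prob_space_distr[OF prob_space_uniform_sphere measurable_uniform_sphere_ident])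

lemma distr_direction_measure_orthogonal:
  fixes f :: "real ^ 'n \<Rightarrow> real ^ 'n"
  assumes f: "orthogonal_transformation f"
  shows "distr direction_measure borel f = direction_measure"
proof -
  have m: "f \<in> borel_measurable borel"
    using f by (intro borel_measurable_continuous_onI linear_continuous_on
        linear_conv_bounded_linear[THEN iffD1] orthogonal_transformation_linear)
  have mf: "f \<in> uniform_sphere \<rightarrow>\<^sub>M uniform_sphere"
    unfolding uniform_sphere_def using m f
    by (intro measurable_restrict_space3) (auto simp: orthogonal_transformation_norm)
  have "distr direction_measure borel f = distr uniform_sphere borel f"
    unfolding direction_measure_def
    by (simp add: distr_distr m measurable_uniform_sphere_ident comp_def)
  also have "\<dots> = distr (distr uniform_sphere uniform_sphere f) borel (\<lambda>x. x)"
    by (simp add: distr_distr mf measurable_uniform_sphere_ident comp_def)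
  finally show ?thesis
    by (simp add: uniform_sphere_rotation_invariant[OF f] direction_measure_def)
qed

text \<open>The cone over the directions orthogonal to \<open>u\<close> lies in a hyperplane, a
  Lebesgue null set, and the measure on the sphere is given by volumes of cones.\<close>

lemma AE_direction_measure_not_orthogonal:
  fixes u :: "real ^ 'n"
  assumes u: "u \<noteq> 0"
  shows "AE \<beta> in direction_measure. \<beta> \<bullet> u \<noteq> 0"
proof -
  let ?A = "{\<beta>. \<beta> \<bullet> u = 0}"
  have "negligible {x. u \<bullet> x = 0}"
    using u by (intro negligible_hyperplane) simp
  then have N: "?A \<in> null_sets lebesgue"
    by (simp add: negligible_iff_null_sets inner_commute)
  have A[measurable]: "?A \<in> sets borel"
    by measurable
  have S: "?A \<inter> sphere 0 1 \<in> sets borel"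
    using A by auto
  have m: "ball 0 1 \<inter> sgn -` (?A \<inter> sphere 0 1) \<in> sets borel"
    using measurable_sets[OF borel_measurable_sgn_vec S] by auto
  have "ball 0 1 \<inter> sgn -` (?A \<inter> sphere 0 1) \<subseteq> ?A"
    by (auto simp: sgn_div_norm)
  then have "ball 0 1 \<inter> sgn -` (?A \<inter> sphere 0 1) \<in> null_sets lebesgue"
    using N by (rule null_sets_completion_subset)
  then have "emeasure lborel (ball 0 1 \<inter> sgn -` (?A \<inter> sphere 0 1)) = 0"
    using m by (simp add: null_sets_def)
  then have "emeasure direction_measure ?A = 0"
    using S unfolding direction_measure_def
    by (subst emeasure_distr)
      (auto simp: measurable_uniform_sphere_ident emeasure_uniform_sphere space_uniform_sphere)
  then show ?thesis
    by (intro AE_I[of _ _ ?A]) (auto simp: A)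
qed

section \<open>Separation of two vectors by a random direction\<close>

text \<open>The closed half-spaces fit the convention of \<open>cdf\<close>: for
  \<open>u = x - w\<close> the condition \<open>\<beta> \<bullet> u \<le> 0\<close> says
  \<open>\<beta> \<bullet> x \<le> \<beta> \<bullet> w\<close>.\<close>

definition separation_prob :: "real ^ 'n \<Rightarrow> real ^ 'n \<Rightarrow> real" where
  "separation_prob u v = measure direction_measure {\<beta>. (\<beta> \<bullet> u \<le> 0) \<noteq> (\<beta> \<bullet> v \<le> 0)}"

lemma separation_prob_scale:
  assumes "0 < a" "0 < b"
  shows "separation_prob (a *\<^sub>R u) (b *\<^sub>R v) = separation_prob u v"
  using assms by (simp add: separation_prob_def mult_le_0_iff)

lemma separation_prob_orthogonal:
  fixes f :: "real ^ 'n \<Rightarrow> real ^ 'n"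
  assumes f: "orthogonal_transformation f"
  shows "separation_prob (f u) (f v) = separation_prob u v"
proof -
  have m: "f \<in> borel_measurable borel"
    using f by (intro borel_measurable_continuous_onI linear_continuous_on
        linear_conv_bounded_linear[THEN iffD1] orthogonal_transformation_linear)
  have ff: "f x \<bullet> f y = x \<bullet> y" for x y
    using f by (simp add: orthogonal_transformation_def)
  have "separation_prob (f u) (f v) =
      measure (distr direction_measure borel f) {\<beta>. (\<beta> \<bullet> f u \<le> 0) \<noteq> (\<beta> \<bullet> f v \<le> 0)}"
    by (simp add: separation_prob_def distr_direction_measure_orthogonal[OF f])
  also have "\<dots> = separation_prob u v"
    by (subst measure_distr) (auto simp: separation_prob_def ff m cong: measurable_cong_sets)
  finally show ?thesis .
qed

text \<open>Off the null set \<open>\<beta> \<bullet> v = 0\<close>, passing from \<open>v\<close>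
  to \<open>- v\<close> changes the side, so the separating events are complementary.\<close>

lemma separation_prob_uminus_right:
  fixes u v :: "real ^ 'n"
  assumes v: "v \<noteq> 0"
  shows "separation_prob u (- v) = 1 - separation_prob u v"
proof -
  interpret D: prob_space "direction_measure :: (real ^ 'n) measure"
    by (rule prob_space_direction_measure)
  let ?S = "{\<beta>. (\<beta> \<bullet> u \<le> 0) \<noteq> (\<beta> \<bullet> v \<le> 0)}"
  have "separation_prob u (- v) = D.prob (space direction_measure - ?S)"
    unfolding separation_prob_def
  proof (rule D.finite_measure_eq_AE)
    show "AE \<beta> in direction_measure. \<beta> \<in> {\<beta>. (\<beta> \<bullet> u \<le> 0) \<noteq> (\<beta> \<bullet> - v \<le> 0)} \<longleftrightarrow>
        \<beta> \<in> space direction_measure - ?S"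
      using AE_direction_measure_not_orthogonal[OF v] by eventually_elim auto
  qed simp_all
  also have "\<dots> = 1 - separation_prob u v"
    unfolding separation_prob_def by (rule D.prob_compl) simp
  finally show ?thesis .
qed

lemma separation_prob_commute: "separation_prob u v = separation_prob v u"
  unfolding separation_prob_def by (intro arg_cong2[where f = measure] refl Collect_cong) auto

lemma separation_prob_same [simp]: "separation_prob u u = 0"
  by (simp add: separation_prob_def)

text \<open>If \<open>\<beta>\<close> does not separate \<open>u\<close> and \<open>w\<close>, their
  nonzero conic combination \<open>v\<close> is on the same side. Hence the events for
  \<open>u, v\<close> and \<open>v, w\<close> are disjoint and make up the event for
  \<open>u, w\<close>.\<close>

lemma separation_prob_add:
  fixes u v w :: "real ^ 'n"
  assumes v: "v = a *\<^sub>R u + b *\<^sub>R w" and ab: "0 \<le> a" "0 \<le> b" "v \<noteq> 0"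
  shows "separation_prob u w = separation_prob u v + separation_prob v w"
proof -
  interpret D: prob_space "direction_measure :: (real ^ 'n) measure"
    by (rule prob_space_direction_measure)
  let ?S = "\<lambda>u v. {\<beta>. (\<beta> \<bullet> u \<le> 0) \<noteq> (\<beta> \<bullet> v \<le> 0)}"
  have between: "(\<beta> \<bullet> v \<le> 0) = (\<beta> \<bullet> u \<le> 0)" if "(\<beta> \<bullet> u \<le> 0) = (\<beta> \<bullet> w \<le> 0)" for \<beta>
  proof (cases "\<beta> \<bullet> u \<le> 0")
    case True
    then show ?thesis
      using that ab by (simp add: v inner_add_right mult_nonneg_nonpos add_nonpos_nonpos)
  next
    case False
    then have "\<beta> \<bullet> u > 0" "\<beta> \<bullet> w > 0"
      using that by auto
    moreover have "a > 0 \<or> b > 0"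
      using ab v by (cases "a = 0"; cases "b = 0") auto
    ultimately have "\<beta> \<bullet> v > 0"
      using ab by (auto simp: v inner_add_right intro: add_pos_nonneg add_nonneg_pos)
    then show ?thesis
      using False by simp
  qed
  have "?S u w = ?S u v \<union> ?S v w" "?S u v \<inter> ?S v w = {}"
    using between by blast+
  then show ?thesis
    unfolding separation_prob_def using D.finite_measure_Union[of "?S u v" "?S v w"] by simp
qed

text \<open>As a function of the angle, the separation probability is additive on
  \<open>[0, pi]\<close> by betweenness and rotation invariance, hence linear; its value at
  \<open>pi\<close> is 1 because opposite vectors are almost surely separated.\<close>

lemma separation_prob_plane:
  fixes e1 e2 :: "real ^ 'n"
  assumes e: "e1 \<bullet> e1 = 1" "e2 \<bullet> e2 = 1" "e1 \<bullet> e2 = 0" and \<alpha>: "0 \<le> \<alpha>" "\<alpha> \<le> pi"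
  shows "separation_prob e1 (cos \<alpha> *\<^sub>R e1 + sin \<alpha> *\<^sub>R e2) = \<alpha> / pi"
proof -
  define p where "p t = cos t *\<^sub>R e1 + sin t *\<^sub>R e2" for t
  define f where "f t = separation_prob (p 0) (p t)" for t
  have e': "e2 \<bullet> e1 = 0"
    using e by (simp add: inner_commute)
  have "p t \<bullet> p t = 1" for t
    by (simp add: p_def inner_add_left inner_add_right e e' flip: power2_eq_square)
  then have p_nz: "p t \<noteq> 0" for t
    by (metis inner_zero_left zero_neq_one)
  have p_pi: "p pi = - p 0"
    by (simp add: p_def)
  have rot: "separation_prob (p (s + r)) (p (t + r)) = separation_prob (p s) (p t)" for s t r
    using separation_prob_orthogonal[OF orthogonal_transformation_plane_rotation(1)[OF e, where t = r],
        of "p s" "p t"]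
    by (simp only: p_def orthogonal_transformation_plane_rotation(2)[OF e])
  \<comment> \<open>Division by \<open>sin (x + y)\<close>, where positive, exhibits
    \<open>p x\<close> as a conic combination of \<open>p 0\<close> and
    \<open>p (x + y)\<close>.\<close>
  have comb: "sin (x + y) *\<^sub>R p x = sin y *\<^sub>R p 0 + sin x *\<^sub>R p (x + y)" for x y
  proof -
    have "sin y = sin (x + y - x)"
      by simp
    also have "\<dots> = sin (x + y) * cos x - cos (x + y) * sin x"
      by (rule sin_diff)
    finally have e: "sin (x + y) * cos x = sin y + sin x * cos (x + y)"
      by simp
    have "sin (x + y) *\<^sub>R p x = (sin (x + y) * cos x) *\<^sub>R e1 + (sin (x + y) * sin x) *\<^sub>R e2"
      by (simp add: p_def scaleR_add_right)
    also have "\<dots> = sin y *\<^sub>R p 0 + sin x *\<^sub>R p (x + y)"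
      unfolding e by (simp add: p_def scaleR_add_right scaleR_add_left mult.commute)
    finally show ?thesis .
  qed
  have add: "f (x + y) = f x + f y" if xy: "0 \<le> x" "0 \<le> y" "x + y \<le> pi" for x y
  proof (cases "x + y = pi")
    \<comment> \<open>The endpoints \<open>p 0\<close> and \<open>p pi\<close> are opposite and
      \<open>sin (x + y) = 0\<close>, so additivity comes from the complement rule instead.\<close>
    case True
    have "f y = separation_prob (p x) (p pi)"
      using rot[of 0 x y] True by (simp add: f_def add.commute)
    also have "\<dots> = 1 - f x"
      unfolding p_pi f_def
      by (subst separation_prob_uminus_right[OF p_nz]) (simp add: separation_prob_commute)
    finally have "f x + f y = 1"
      by simp
    moreover have "f pi = 1"
      unfolding f_def p_pi by (subst separation_prob_uminus_right[OF p_nz]) simp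
    ultimately show ?thesis
      using True by simp
  next
    case False
    show ?thesis
    proof (cases "x + y = 0")
      case True
      with xy have "x = 0" "y = 0"
        by auto
      then show ?thesis
        by (simp add: f_def)
    next
      case nz: False
      with False xy have s: "sin (x + y) > 0"
        by (intro sin_gt_zero) auto
      have "p x = (1 / sin (x + y)) *\<^sub>R (sin (x + y) *\<^sub>R p x)"
        using s by simp
      also have "\<dots> = (sin y / sin (x + y)) *\<^sub>R p 0 + (sin x / sin (x + y)) *\<^sub>R p (x + y)"
        unfolding comb by (simp only: scaleR_add_right scaleR_scaleR times_divide_eq_left mult_1)
      finally have "separation_prob (p 0) (p (x + y)) =
          separation_prob (p 0) (p x) + separation_prob (p x) (p (x + y))"
        by (rule separation_prob_add) (use s xy in \<open>auto intro!: divide_nonneg_pos sin_ge_zero p_nz\<close>)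
      then show ?thesis
        using rot[of 0 x y] by (simp add: f_def add.commute)
    qed
  qed
  have "f \<alpha> = \<alpha> / pi * f pi"
    by (rule additive_nonneg_imp_linear) (use \<alpha> add in \<open>auto simp: f_def separation_prob_def\<close>)
  moreover have "f pi = 1"
    unfolding f_def p_pi by (subst separation_prob_uminus_right[OF p_nz]) simp
  ultimately show ?thesis
    by (simp add: f_def p_def)
qed

text \<open>Normalisation and Gram-Schmidt give an orthonormal pair in which the second unit vector
  has the cosine and sine of the angle as coordinates.\<close>

lemma separation_prob_eq_ang:
  fixes u v :: "real ^ 'n"
  assumes u: "u \<noteq> 0" and v: "v \<noteq> 0"
  shows "separation_prob u v = ang u v / pi"
proof -
  define a b where "a = sgn u" and "b = sgn v"
  define c where "c = a \<bullet> b"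
  have aa: "a \<bullet> a = 1" and bb: "b \<bullet> b = 1"
    using u v by (simp_all add: a_def b_def norm_sgn flip: norm_eq_1)
  have ang: "ang u v = arccos c"
    by (simp add: ang_def c_def a_def b_def sgn_div_norm field_simps)
  have sep: "separation_prob u v = separation_prob a b"
    using u v by (simp add: a_def b_def sgn_div_norm separation_prob_scale)
  have "\<bar>c\<bar> \<le> norm a * norm b"
    unfolding c_def by (rule Cauchy_Schwarz_ineq2)
  then have c: "-1 \<le> c" "c \<le> 1"
    using aa bb by (auto simp: norm_eq_1[symmetric])
  define w where "w = b - c *\<^sub>R a"
  have ww: "w \<bullet> w = 1 - c\<^sup>2"
    by (simp add: w_def inner_diff_left inner_diff_right aa bb inner_commute[of b a]
        flip: c_def) (simp add: power2_eq_square)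
  have aw: "a \<bullet> w = 0"
    by (simp add: w_def inner_diff_right aa flip: c_def)
  show ?thesis
  proof (cases "w = 0")
    \<comment> \<open>Parallel unit vectors leave no second axis: either \<open>b = a\<close> with
      angle 0, or \<open>b = - a\<close> with angle \<open>pi\<close>.\<close>
    case True
    then have bc: "b = c *\<^sub>R a" and "c\<^sup>2 = 1"
      using ww by (simp_all add: w_def)
    then consider "c = 1" | "c = -1"
      by (auto simp: power2_eq_1_iff)
    then show ?thesis
    proof cases
      case 1
      then show ?thesis
        using bc by (simp add: ang sep)
    next
      case 2
      have "a \<noteq> 0"
        using aa by auto
      then show ?thesis
        using 2 bc by (simp add: ang sep separation_prob_uminus_right)
    qed
  next
    case False
    define e where "e = (1 / norm w) *\<^sub>R w"
    have nw: "norm w = sin (arccos c)"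
      using c ww by (simp add: sin_arccos_abs norm_eq_sqrt_inner)
    then have b: "b = cos (arccos c) *\<^sub>R a + sin (arccos c) *\<^sub>R e"
      using c False w_def by (simp add: e_def flip: nw)
    have "e \<bullet> e = 1" "a \<bullet> e = 0"
      using False by (simp_all add: e_def aw flip: power2_norm_eq_inner power2_eq_square) 
    then show ?thesis
      unfolding ang sep using b aa separation_prob_plane[of a e "arccos c"] c
      by (simp add: arccos_lbound arccos_ubound)
  qed
qed

section \<open>Mixtures and distribution functions\<close>

text \<open>A coin of bias \<open>\<theta>\<close> picks the law. One construction serves both
  \<open>half_mixture\<close> and the Stieltjes measure in \<open>cvm_dist_sq\<close>, and as a bind
  it inherits being a probability measure.\<close>

definition mixture :: "real \<Rightarrow> 'a measure \<Rightarrow> 'a measure \<Rightarrow> 'a measure" where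
  "mixture \<theta> P Q = measure_pmf (bernoulli_pmf \<theta>) \<bind> (\<lambda>b. if b then P else Q)"

lemma
  assumes P: "prob_space P" "sets P = sets borel" and Q: "prob_space Q" "sets Q = sets borel"
  shows sets_mixture: "sets (mixture \<theta> P Q) = sets borel"
    and prob_space_mixture: "prob_space (mixture \<theta> P Q)"
    and nn_integral_mixture: "0 \<le> \<theta> \<Longrightarrow> \<theta> \<le> 1 \<Longrightarrow> f \<in> borel_measurable borel \<Longrightarrow>
      (\<integral>\<^sup>+x. f x \<partial>mixture \<theta> P Q) = ennreal \<theta> * (\<integral>\<^sup>+x. f x \<partial>P) + ennreal (1 - \<theta>) * (\<integral>\<^sup>+x. f x \<partial>Q)"
proof -
  have K: "(\<lambda>b. if b then P else Q) \<in> measure_pmf (bernoulli_pmf \<theta>) \<rightarrow>\<^sub>M subprob_algebra borel"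
    using assms by (auto simp: measurable_def space_subprob_algebra prob_space_imp_subprob_space)
  show "sets (mixture \<theta> P Q) = sets borel"
    unfolding mixture_def using assms by (intro sets_bind) auto
  show "prob_space (mixture \<theta> P Q)"
    unfolding mixture_def by (rule measure_pmf.prob_space_bind[OF _ K]) (use assms in auto)
  show "(\<integral>\<^sup>+x. f x \<partial>mixture \<theta> P Q) = ennreal \<theta> * (\<integral>\<^sup>+x. f x \<partial>P) + ennreal (1 - \<theta>) * (\<integral>\<^sup>+x. f x \<partial>Q)"
    if "0 \<le> \<theta>" "\<theta> \<le> 1" and f: "f \<in> borel_measurable borel"
    unfolding mixture_def using that by (subst nn_integral_bind[OF f K]) (simp add: mult.commute)
qed

lemma integral_mixture:
  fixes f :: "'a::topological_space \<Rightarrow> real"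
  assumes P: "prob_space P" "sets P = sets borel" and Q: "prob_space Q" "sets Q = sets borel"
    and \<theta>: "0 \<le> \<theta>" "\<theta> \<le> 1"
    and f: "f \<in> borel_measurable borel" "\<And>x. 0 \<le> f x" "\<And>x. f x \<le> C"
  shows "(\<integral>x. f x \<partial>mixture \<theta> P Q) = \<theta> * (\<integral>x. f x \<partial>P) + (1 - \<theta>) * (\<integral>x. f x \<partial>Q)"
proof -
  have m: "f \<in> borel_measurable N" if "sets N = sets borel" for N
    using f(1) that by (simp cong: measurable_cong_sets)
  have I: "integrable N f" if "prob_space N" "sets N = sets borel" for N
    using prob_space.finite_measure[OF that(1)] m[OF that(2)] f
    by (intro finite_measure.integrable_const_bound[of _ _ C]) auto
  have "ennreal (\<integral>x. f x \<partial>mixture \<theta> P Q) = (\<integral>\<^sup>+x. f x \<partial>mixture \<theta> P Q)"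
    using f by (intro nn_integral_eq_integral[symmetric] I sets_mixture prob_space_mixture P Q) auto
  also have "\<dots> = ennreal \<theta> * (\<integral>\<^sup>+x. f x \<partial>P) + ennreal (1 - \<theta>) * (\<integral>\<^sup>+x. f x \<partial>Q)"
    using f by (intro nn_integral_mixture P Q \<theta>) simp
  also have "\<dots> = ennreal (\<theta> * (\<integral>x. f x \<partial>P) + (1 - \<theta>) * (\<integral>x. f x \<partial>Q))"
    using f \<theta> I P Q by (simp add: nn_integral_eq_integral ennreal_mult integral_nonneg)
  finally show ?thesis
    using f \<theta> by (subst (asm) ennreal_inj) (auto intro!: add_nonneg_nonneg mult_nonneg_nonneg integral_nonneg)
qed

lemma half_mixture_eq_mixture:
  assumes P: "prob_space P" "sets P = sets borel" and Q: "prob_space Q" "sets Q = sets borel"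
  shows "half_mixture P Q = mixture (1 / 2) P Q"
proof (rule measure_eqI)
  fix A assume "A \<in> sets (half_mixture P Q)"
  then have A: "A \<in> sets borel" "A \<in> sets P" "A \<in> sets Q"
    using P Q by (simp_all add: sets_half_mixture)
  have "emeasure (mixture (1 / 2) P Q) A = (\<integral>\<^sup>+x. indicator A x \<partial>mixture (1 / 2) P Q)"
    using A by (simp add: sets_mixture[OF P Q])
  also have "\<dots> = ennreal (1 / 2) * emeasure P A + ennreal (1 / 2) * emeasure Q A"
    using A by (subst nn_integral_mixture[OF P Q]) simp_all
  also have "ennreal (1 / 2) = 1 / 2"
    using ennreal_divide_numeral[of 1 "num.Bit0 num.One"] by simp
  finally show "emeasure (half_mixture P Q) A = emeasure (mixture (1 / 2) P Q) A"
    using A P Q by (simp add: emeasure_half_mixture)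
qed (simp add: sets_half_mixture sets_mixture[OF P Q] P)

text \<open>A law on the line is determined by its distribution function, and that of a mixture is
  the mixture of the distribution functions. This turns the Stieltjes integral in
  \<open>cvm_dist_sq\<close> into an integral over a mixture.\<close>

lemma interval_measure_mixture_cdf:
  assumes P: "real_distribution P" and Q: "real_distribution Q" and \<theta>: "0 \<le> \<theta>" "\<theta> \<le> 1"
  shows "interval_measure (\<lambda>s. \<theta> * cdf P s + (1 - \<theta>) * cdf Q s) = mixture \<theta> P Q"
proof (rule cdf_unique)
  interpret P: real_distribution P by (rule P)
  interpret Q: real_distribution Q by (rule Q)
  let ?K = "\<lambda>s. \<theta> * cdf P s + (1 - \<theta>) * cdf Q s"
  note PQ = P.prob_space_axioms P.events_eq_borel Q.prob_space_axioms Q.events_eq_borel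
  have mono: "?K x \<le> ?K y" if "x \<le> y" for x y
    using that \<theta> by (intro add_mono mult_left_mono P.cdf_nondecreasing Q.cdf_nondecreasing) auto
  have rc: "continuous (at_right a) ?K" for a
    by (intro continuous_intros P.cdf_is_right_cont Q.cdf_is_right_cont)
  have "(?K \<longlongrightarrow> \<theta> * 0 + (1 - \<theta>) * 0) at_bot"
    by (intro tendsto_intros P.cdf_lim_at_bot Q.cdf_lim_at_bot)
  then have bot: "(?K \<longlongrightarrow> 0) at_bot"
    by simp
  have "(?K \<longlongrightarrow> \<theta> * 1 + (1 - \<theta>) * 1) at_top"
    by (intro tendsto_intros P.cdf_lim_at_top_prob Q.cdf_lim_at_top_prob)
  then have top: "(?K \<longlongrightarrow> 1) at_top"
    by simp
  show "real_distribution (interval_measure ?K)"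
    by (rule real_distribution_interval_measure[OF mono rc bot top])
  show *: "real_distribution (mixture \<theta> P Q)"
    using sets_mixture[OF PQ] prob_space_mixture[OF PQ]
    by (auto simp: real_distribution_def real_distribution_axioms_def)
  show "cdf (interval_measure ?K) = cdf (mixture \<theta> P Q)"
  proof
    fix x
    interpret N: real_distribution "mixture \<theta> P Q" by (rule *)
    have "cdf (interval_measure ?K) x = ?K x"
      by (simp add: cdf_interval_measure[OF mono rc bot])
    also have "\<dots> = cdf (mixture \<theta> P Q) x"
      using integral_mixture[OF PQ \<theta>, of "indicator {..x}" 1] by (simp add: cdf_def)
    finally show "cdf (interval_measure ?K) x = cdf (mixture \<theta> P Q) x" .
  qed
qed

section \<open>Integrals of bounded functions and of distribution functions\<close>

lemma integrable_prob_bounded: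
  fixes f :: "'a \<Rightarrow> real"
  assumes "prob_space M" "f \<in> borel_measurable M" "\<And>x. \<bar>f x\<bar> \<le> C"
  shows "integrable M f"
  using assms by (intro finite_measure.integrable_const_bound[of _ _ C] prob_space.finite_measure) auto

lemma abs_integral_prob_le:
  fixes f :: "'a \<Rightarrow> real"
  assumes M: "prob_space M" and f: "\<And>x. \<bar>f x\<bar> \<le> C"
  shows "\<bar>\<integral>x. f x \<partial>M\<bar> \<le> C"
proof (cases "integrable M f")
  case True
  interpret prob_space M by (rule M)
  have "\<bar>\<integral>x. f x \<partial>M\<bar> \<le> (\<integral>x. \<bar>f x\<bar> \<partial>M)"
    by (rule integral_abs_bound)
  also have "\<dots> \<le> (\<integral>x. C \<partial>M)"
    using True f by (intro integral_mono) auto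
  finally show ?thesis
    by (simp add: prob_space)
next
  \<comment> \<open>The integral then has its default value 0, and \<open>C\<close> is nonnegative
    as a bound of absolute values.\<close>
  case False
  then show ?thesis
    using f[of undefined] by (simp add: not_integrable_integral_eq)
qed

lemma integral_swap_bounded:
  fixes f :: "'a \<Rightarrow> 'b \<Rightarrow> real"
  assumes A: "prob_space A" and B: "prob_space B"
    and f: "case_prod f \<in> borel_measurable (A \<Otimes>\<^sub>M B)" and b: "\<And>x y. \<bar>f x y\<bar> \<le> C"
  shows "(\<integral>x. \<integral>y. f x y \<partial>B \<partial>A) = (\<integral>y. \<integral>x. f x y \<partial>A \<partial>B)"
proof -
  interpret A: prob_space A by (rule A)
  interpret B: prob_space B by (rule B)
  interpret AB: pair_prob_space A B ..
  have "integrable (A \<Otimes>\<^sub>M B) (case_prod f)"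
    using f b by (intro AB.P.integrable_const_bound[of _ C]) (auto simp: split_beta)
  then show ?thesis
    by (rule AB.Fubini_integral[symmetric])
qed

lemma (in real_distribution) cdf_eq_integral: "cdf M x = (\<integral>y. of_bool (y \<le> x) \<partial>M)"
proof -
  have "(\<lambda>y. of_bool (y \<le> x)) = (indicator {..x} :: real \<Rightarrow> real)"
    by (auto simp: indicator_def)
  then show ?thesis
    by (simp add: cdf_def)
qed

text \<open>Among three independent variables with continuous distributions, almost surely exactly one is
  the largest.\<close>

lemma integral_cdf_products:
  assumes "real_distribution A" "real_distribution B" "real_distribution C"
    and contA: "\<And>x. isCont (cdf A) x" and contB: "\<And>x. isCont (cdf B) x"
    and contC: "\<And>x. isCont (cdf C) x"
  shows "(\<integral>x. cdf B x * cdf C x \<partial>A) + (\<integral>x. cdf A x * cdf C x \<partial>B) + (\<integral>x. cdf A x * cdf B x \<partial>C) = 1"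
proof -
  interpret A: real_distribution A by fact
  interpret B: real_distribution B by fact
  interpret C: real_distribution C by fact
  have mA [measurable]: "cdf A \<in> borel_measurable borel"
    and mB [measurable]: "cdf B \<in> borel_measurable borel"
    and mC [measurable]: "cdf C \<in> borel_measurable borel"
    using contA contB contC
    by (auto intro!: borel_measurable_continuous_onI continuous_at_imp_continuous_on)
  note [measurable_cong] = A.events_eq_borel B.events_eq_borel C.events_eq_borel
  note bnd = A.cdf_nonneg B.cdf_nonneg C.cdf_nonneg A.cdf_bounded_prob B.cdf_bounded_prob C.cdf_bounded_prob
  \<comment> \<open>Continuity of \<open>cdf B\<close> excludes atoms of \<open>B\<close>, so ties
    between the first two variables have probability zero.\<close>
  have AE_neq: "AE y in B. y \<noteq> x" for x
  proof (rule AE_I[of _ _ "{x}"])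
    show "emeasure B {x} = 0"
      using contB[of x] by (simp add: B.isCont_cdf B.emeasure_eq_measure)
  qed auto
  let ?i = "\<lambda>x y::real. of_bool (x \<le> y) :: real"
  \<comment> \<open>All three integrals are brought to the form of a double integral over
    \<open>A\<close> and \<open>B\<close>, with the variable of law \<open>C\<close> integrated
    out.\<close>
  have 1: "(\<integral>x. cdf B x * cdf C x \<partial>A) = (\<integral>x. \<integral>y. ?i y x * cdf C x \<partial>B \<partial>A)"
    by (simp add: B.cdf_eq_integral)
  have 2: "(\<integral>y. cdf A y * cdf C y \<partial>B) = (\<integral>x. \<integral>y. ?i x y * cdf C y \<partial>B \<partial>A)"
  proof -
    have "(\<integral>y. cdf A y * cdf C y \<partial>B) = (\<integral>y. \<integral>x. ?i x y * cdf C y \<partial>A \<partial>B)"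
      by (simp add: A.cdf_eq_integral)
    also have "\<dots> = (\<integral>x. \<integral>y. ?i x y * cdf C y \<partial>B \<partial>A)"
      using bnd by (intro integral_swap_bounded[where C=1] A.prob_space_axioms B.prob_space_axioms) auto
    finally show ?thesis .
  qed
  \<comment> \<open>The complement is the open ray below \<open>max x y\<close>; as \<open>C\<close>
    has no atom at that point, the closed ray has the same mass.\<close>
  have C_ge: "(\<integral>z. ?i x z * ?i y z \<partial>C) = 1 - cdf C (max x y)" for x y
  proof -
    have "(\<integral>z. ?i x z * ?i y z \<partial>C) = (\<integral>z. indicator (space C - {..<max x y}) z \<partial>C)"
      by (intro Bochner_Integration.integral_cong) (auto simp: indicator_def)
    also have "\<dots> = 1 - C.prob {..<max x y}"
      using C.prob_compl[of "{..<max x y}"] by simp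
    also have "C.prob {..<max x y} = cdf C (max x y)"
    proof -
      have "C.prob {..max x y} = C.prob ({..<max x y} \<union> {max x y})"
        by (intro arg_cong[of _ _ C.prob]) auto
      also have "\<dots> = C.prob {..<max x y} + C.prob {max x y}"
        by (rule C.finite_measure_Union) auto
      finally show ?thesis
        using contC[of "max x y"] unfolding C.isCont_cdf by (simp add: cdf_def)
    qed
    finally show ?thesis .
  qed
  have 3: "(\<integral>z. cdf A z * cdf B z \<partial>C) = (\<integral>x. \<integral>y. 1 - cdf C (max x y) \<partial>B \<partial>A)"
  proof -
    have "(\<integral>z. cdf A z * cdf B z \<partial>C) = (\<integral>z. \<integral>x. ?i x z * cdf B z \<partial>A \<partial>C)"
      by (simp add: A.cdf_eq_integral)
    also have "\<dots> = (\<integral>x. \<integral>z. ?i x z * cdf B z \<partial>C \<partial>A)"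
      using bnd by (intro integral_swap_bounded[where C=1] A.prob_space_axioms C.prob_space_axioms) auto
    also have "\<dots> = (\<integral>x. \<integral>z. \<integral>y. ?i x z * ?i y z \<partial>B \<partial>C \<partial>A)"
      by (simp add: B.cdf_eq_integral)
    also have "\<dots> = (\<integral>x. \<integral>y. \<integral>z. ?i x z * ?i y z \<partial>C \<partial>B \<partial>A)"
      by (intro Bochner_Integration.integral_cong refl integral_swap_bounded[where C=1]
          B.prob_space_axioms C.prob_space_axioms) auto
    finally show ?thesis
      by (simp add: C_ge)
  qed
  have I: "integrable B (\<lambda>y. f x y)" "integrable A (\<lambda>x. \<integral>y. f x y \<partial>B)"
    if "case_prod f \<in> borel_measurable (borel \<Otimes>\<^sub>M borel)" "\<And>x y. \<bar>f x y\<bar> \<le> 1" for f :: "real \<Rightarrow> real \<Rightarrow> real" and x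
    using that(1) by (auto intro!: integrable_prob_bounded[where C=1] abs_integral_prob_le
        A.prob_space_axioms B.prob_space_axioms that(2))
  \<comment> \<open>Given \<open>x\<close> and \<open>y\<close>, these are the probabilities that
    \<open>x\<close>, \<open>y\<close> or the third variable is the largest.\<close>
  define f1 where "f1 x y = ?i y x * cdf C x" for x y
  define f2 where "f2 x y = ?i x y * cdf C y" for x y
  define f3 where "f3 x y = 1 - cdf C (max x y)" for x y
  have m [measurable]: "case_prod f1 \<in> borel_measurable (borel \<Otimes>\<^sub>M borel)"
      "case_prod f2 \<in> borel_measurable (borel \<Otimes>\<^sub>M borel)"
      "case_prod f3 \<in> borel_measurable (borel \<Otimes>\<^sub>M borel)"
    unfolding f1_def f2_def f3_def by measurable
  have b: "\<bar>f1 x y\<bar> \<le> 1" "\<bar>f2 x y\<bar> \<le> 1" "\<bar>f3 x y\<bar> \<le> 1" for x y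
    using bnd by (auto simp: f1_def f2_def f3_def)
  note I' = I[OF m(1) b(1)] I[OF m(2) b(2)] I[OF m(3) b(3)]
  have 1: "(\<integral>x. cdf B x * cdf C x \<partial>A) = (\<integral>x. \<integral>y. f1 x y \<partial>B \<partial>A)"
    unfolding f1_def by (rule 1)
  have 2: "(\<integral>y. cdf A y * cdf C y \<partial>B) = (\<integral>x. \<integral>y. f2 x y \<partial>B \<partial>A)"
    unfolding f2_def by (rule 2)
  have 3: "(\<integral>z. cdf A z * cdf B z \<partial>C) = (\<integral>x. \<integral>y. f3 x y \<partial>B \<partial>A)"
    unfolding f3_def by (rule 3)
  have "(\<integral>x. cdf B x * cdf C x \<partial>A) + (\<integral>x. cdf A x * cdf C x \<partial>B) + (\<integral>x. cdf A x * cdf B x \<partial>C) =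
      (\<integral>x. \<integral>y. f1 x y + f2 x y + f3 x y \<partial>B \<partial>A)"
    unfolding 1 2 3 using I' by simp
  also have "\<dots> = (\<integral>x. \<integral>y. 1 \<partial>B \<partial>A)"
  proof (rule Bochner_Integration.integral_cong[OF refl])
    fix x
    show "(\<integral>y. f1 x y + f2 x y + f3 x y \<partial>B) = (\<integral>y. 1 \<partial>B)"
    proof (rule integral_cong_AE)
      show "AE y in B. f1 x y + f2 x y + f3 x y = 1"
        \<comment> \<open>For \<open>x \<noteq> y\<close> one of \<open>f1\<close> and
          \<open>f2\<close> is 0 and the other is \<open>cdf C (max x y)\<close>, which
          \<open>f3\<close> completes to 1; a tie would count this value twice.\<close>
        using AE_neq[of x] by eventually_elim (auto simp: f1_def f2_def f3_def max_def)
    qed measurable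
  qed
  finally show ?thesis
    using A.prob_space B.prob_space by simp
qed

text \<open>Write F and G for the distribution functions of \<open>A\<close> and \<open>B\<close>.
  The triples AAA and BBB give 1/3 for the pure terms; AAB gives the integral of F^2 over
  \<open>B\<close> as 1 minus twice that of FG over \<open>A\<close>, and ABB does so symmetrically.
  Both sides equal 4/3 minus twice the integrals of FG over \<open>A\<close> and over
  \<open>B\<close>.\<close>

lemma integral_cdf_diff_squared:
  assumes "real_distribution A" "real_distribution B"
    and contA: "\<And>x. isCont (cdf A) x" and contB: "\<And>x. isCont (cdf B) x"
  shows "(\<integral>x. (cdf A x - cdf B x)\<^sup>2 \<partial>A) = (\<integral>x. (cdf A x - cdf B x)\<^sup>2 \<partial>B)"
proof -
  interpret A: real_distribution A by fact
  interpret B: real_distribution B by fact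
  have [measurable]: "cdf A \<in> borel_measurable borel" "cdf B \<in> borel_measurable borel"
    using contA contB by (auto intro!: borel_measurable_continuous_onI continuous_at_imp_continuous_on)
  have expand: "(\<integral>x. (cdf A x - cdf B x)\<^sup>2 \<partial>M) =
      (\<integral>x. cdf A x * cdf A x \<partial>M) - 2 * (\<integral>x. cdf A x * cdf B x \<partial>M) + (\<integral>x. cdf B x * cdf B x \<partial>M)"
    if "real_distribution M" for M
  proof -
    interpret M: real_distribution M by fact
    have "integrable M (\<lambda>x. cdf A x * cdf A x)" "integrable M (\<lambda>x. cdf A x * cdf B x)"
        "integrable M (\<lambda>x. cdf B x * cdf B x)"
      by (auto intro!: integrable_prob_bounded[where C=1] M.prob_space_axioms M.measurable_finite_borel mult_le_one
          simp: abs_mult A.cdf_nonneg B.cdf_nonneg A.cdf_bounded_prob B.cdf_bounded_prob)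
    moreover have "(cdf A x - cdf B x)\<^sup>2 = cdf A x * cdf A x - 2 * (cdf A x * cdf B x) + cdf B x * cdf B x" for x
      by (simp add: power2_eq_square algebra_simps)
    ultimately show ?thesis
      by simp
  qed
  note T = integral_cdf_products
  show ?thesis
    using T[OF assms(1,1,1) contA contA contA] T[OF assms(2,2,2) contB contB contB]
      T[OF assms(1,1,2) contA contA contB] T[OF assms(1,2,2) contA contB contB]
    unfolding expand[OF assms(1)] expand[OF assms(2)] by (simp add: mult.commute)
qed

section \<open>The energy representation\<close>

lemma borel_measurable_inner_const [measurable, simp]:
  "(\<bullet>) (\<beta> :: 'a::euclidean_space) \<in> borel_measurable borel"
  by (intro borel_measurable_continuous_onI continuous_intros)

lemma real_distribution_projection:
  fixes P :: "(real ^ 'n) measure"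
  assumes "prob_space P" "sets P = sets borel"
  shows "real_distribution (distr P borel (\<lambda>x. \<beta> \<bullet> x))"
  using assms
  by (auto simp: real_distribution_def real_distribution_axioms_def cong: measurable_cong_sets
      intro!: prob_space.prob_space_distr)

lemma proj_cdf_eq_integral:
  fixes P :: "(real ^ 'n) measure"
  assumes "prob_space P" "sets P = sets borel"
  shows "proj_cdf P \<beta> t = (\<integral>x. of_bool (\<beta> \<bullet> x \<le> t) \<partial>P)"
proof -
  have [measurable_cong]: "sets P = sets borel" by fact
  interpret D: real_distribution "distr P borel (\<lambda>x. \<beta> \<bullet> x)"
    by (rule real_distribution_projection[OF assms])
  show ?thesis
    unfolding proj_cdf_def D.cdf_eq_integral by (subst integral_distr) simp_all
qed

lemma proj_cdf_bounds:
  assumes "prob_space P" "sets P = sets borel"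
  shows "0 \<le> proj_cdf P \<beta> t" "proj_cdf P \<beta> t \<le> 1"
proof -
  interpret D: real_distribution "distr P borel (\<lambda>x. \<beta> \<bullet> x)"
    by (rule real_distribution_projection[OF assms])
  show "0 \<le> proj_cdf P \<beta> t" "proj_cdf P \<beta> t \<le> 1"
    unfolding proj_cdf_def by (rule D.cdf_nonneg D.cdf_bounded_prob)+
qed

text \<open>Measurability is wanted jointly in direction and threshold, since the threshold
  \<open>\<beta> \<bullet> w\<close> varies with \<open>\<beta>\<close>; the parameter integral of
  an indicator provides it.\<close>

lemma measurable_proj_cdf:
  fixes P :: "(real ^ 'n) measure"
  assumes P: "prob_space P" "sets P = sets borel"
    and [measurable]: "f \<in> borel_measurable M" "g \<in> borel_measurable M"
  shows "(\<lambda>x. proj_cdf P (f x) (g x)) \<in> borel_measurable M"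
proof -
  have [measurable_cong]: "sets P = sets borel" by fact
  interpret prob_space P by fact
  show ?thesis
    unfolding proj_cdf_eq_integral[OF P] by measurable
qed

section \<open>The distance as an integral over the equal-weight mixture\<close>

text \<open>By \<open>integral_cdf_diff_squared\<close> the integrals against the two projected laws
  agree for almost every direction, so the weight \<open>\<theta>\<close> can be exchanged for 1/2,
  which yields an integral over \<open>half_mixture\<close>.\<close>

lemma cvm_dist_sq_eq_integral_half_mixture:
  fixes P Q :: "(real ^ 'n) measure"
  assumes P: "prob_space P" "sets P = sets borel" and Q: "prob_space Q" "sets Q = sets borel"
    and cont: "AE \<beta> in uniform_sphere.
           continuous_on UNIV (proj_cdf P \<beta>) \<and> continuous_on UNIV (proj_cdf Q \<beta>)"
    and \<theta>: "0 \<le> \<theta>" "\<theta> \<le> 1"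
  shows "cvm_dist_sq \<theta> P Q = (\<integral>\<beta>. \<integral>w. (proj_cdf P \<beta> (\<beta> \<bullet> w) - proj_cdf Q \<beta> (\<beta> \<bullet> w))\<^sup>2
           \<partial>half_mixture P Q \<partial>direction_measure)"
proof -
  have [measurable_cong]: "sets P = sets borel" "sets Q = sets borel" by fact+
  interpret P: prob_space P by (rule P)
  interpret Q: prob_space Q by (rule Q)
  note [measurable] = measurable_proj_cdf[OF P] measurable_proj_cdf[OF Q]
  define D where "D \<beta> t = (proj_cdf P \<beta> t - proj_cdf Q \<beta> t)\<^sup>2" for \<beta> t
  have D_meas [measurable]: "(\<lambda>x. D (f x) (g x)) \<in> borel_measurable M"
    if [measurable]: "f \<in> borel_measurable M" "g \<in> borel_measurable M" for f g and M :: "'c measure"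
    unfolding D_def by measurable
  have D_bounds: "0 \<le> D \<beta> t" "D \<beta> t \<le> 1" for \<beta> t
    using proj_cdf_bounds[OF P, of \<beta> t] proj_cdf_bounds[OF Q, of \<beta> t]
    by (auto simp: D_def abs_square_le_1)
  define a where "a \<beta> = (\<integral>w. D \<beta> (\<beta> \<bullet> w) \<partial>P)" for \<beta>
  define b where "b \<beta> = (\<integral>w. D \<beta> (\<beta> \<bullet> w) \<partial>Q)" for \<beta>
  have [measurable]: "a \<in> borel_measurable borel" "b \<in> borel_measurable borel"
    unfolding a_def b_def by measurable
  have [measurable]: "a \<in> borel_measurable uniform_sphere" "b \<in> borel_measurable uniform_sphere"
    by (auto intro!: measurable_compose[OF measurable_uniform_sphere_ident])
  let ?dP = "\<lambda>\<beta>. distr P borel (\<lambda>x. \<beta> \<bullet> x)" and ?dQ = "\<lambda>\<beta>. distr Q borel (\<lambda>x. \<beta> \<bullet> x)"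
  note rd = real_distribution_projection[OF P] real_distribution_projection[OF Q]
  have a_distr: "(\<integral>t. D \<beta> t \<partial>?dP \<beta>) = a \<beta>" and b_distr: "(\<integral>t. D \<beta> t \<partial>?dQ \<beta>) = b \<beta>" for \<beta>
    unfolding a_def b_def by (subst integral_distr; simp)+
  have ps: "prob_space (?dP \<beta>)" "prob_space (?dQ \<beta>)" for \<beta>
    using rd[of \<beta>] by (simp_all add: real_distribution_def)
  have "cvm_dist_sq \<theta> P Q = (\<integral>\<beta>. \<theta> * a \<beta> + (1 - \<theta>) * b \<beta> \<partial>uniform_sphere)"
    unfolding cvm_dist_sq_def
  proof (intro Bochner_Integration.integral_cong refl)
    fix \<beta> :: "real ^ 'n"
    have "(LINT t|interval_measure (\<lambda>s. \<theta> * proj_cdf P \<beta> s + (1 - \<theta>) * proj_cdf Q \<beta> s).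
          (proj_cdf P \<beta> t - proj_cdf Q \<beta> t)\<^sup>2) = (\<integral>t. D \<beta> t \<partial>mixture \<theta> (?dP \<beta>) (?dQ \<beta>))"
      unfolding interval_measure_mixture_cdf[OF rd \<theta>, symmetric] by (simp add: D_def proj_cdf_def)
    also have "\<dots> = \<theta> * a \<beta> + (1 - \<theta>) * b \<beta>"
      unfolding a_distr[symmetric] b_distr[symmetric]
      by (rule integral_mixture[where C=1]) (auto intro!: ps \<theta> D_bounds)
    finally show "(LINT t|interval_measure (\<lambda>s. \<theta> * proj_cdf P \<beta> s + (1 - \<theta>) * proj_cdf Q \<beta> s).
          (proj_cdf P \<beta> t - proj_cdf Q \<beta> t)\<^sup>2) = \<theta> * a \<beta> + (1 - \<theta>) * b \<beta>" .
  qed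
  \<comment> \<open>Continuity of both projections, valid in almost every direction, gives
    \<open>a \<beta> = b \<beta>\<close> there.\<close>
  also have "\<dots> = (\<integral>\<beta>. 1 / 2 * a \<beta> + (1 - 1 / 2) * b \<beta> \<partial>uniform_sphere)"
  proof (rule integral_cong_AE)
    show "AE \<beta> in uniform_sphere. \<theta> * a \<beta> + (1 - \<theta>) * b \<beta> = 1 / 2 * a \<beta> + (1 - 1 / 2) * b \<beta>"
      using cont
    proof eventually_elim
      case (elim \<beta>)
      then have "isCont (cdf (?dP \<beta>)) t" "isCont (cdf (?dQ \<beta>)) t" for t
        by (auto simp: proj_cdf_def continuous_on_eq_continuous_at)
      then have "a \<beta> = b \<beta>"
        using integral_cdf_diff_squared[OF rd, of \<beta> \<beta>] unfolding a_distr[symmetric] b_distr[symmetric]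
        by (simp add: D_def[abs_def] proj_cdf_def)
      then show ?case
        by (simp add: algebra_simps)
    qed
  qed measurable
  also have "\<dots> = (\<integral>\<beta>. 1 / 2 * a \<beta> + (1 - 1 / 2) * b \<beta> \<partial>direction_measure)"
    unfolding direction_measure_def by (rule integral_distr[OF measurable_uniform_sphere_ident, symmetric]) measurable
  also have "\<dots> = (\<integral>\<beta>. \<integral>w. D \<beta> (\<beta> \<bullet> w) \<partial>half_mixture P Q \<partial>direction_measure)"
  proof (intro Bochner_Integration.integral_cong refl)
    fix \<beta> :: "real ^ 'n"
    show "1 / 2 * a \<beta> + (1 - 1 / 2) * b \<beta> = (\<integral>w. D \<beta> (\<beta> \<bullet> w) \<partial>half_mixture P Q)"
      unfolding half_mixture_eq_mixture[OF P Q] a_def b_def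
      by (rule integral_mixture[OF P Q, where C=1, symmetric]) (auto intro!: D_bounds)
  qed
  finally show ?thesis
    by (simp add: D_def)
qed

section \<open>The expected angular distance\<close>

text \<open>With the default value at zero vectors included, the formula is total, so measurability
  and bounds of \<open>ang\<close> follow from those of \<open>separation_prob\<close>.\<close>

lemma ang_eq_separation_prob:
  fixes u v :: "real ^ 'n"
  shows "ang u v = (if u = 0 \<or> v = 0 then pi / 2 else pi * separation_prob u v)"
  by (auto simp: separation_prob_eq_ang) (auto simp: ang_def)

text \<open>The angle is replaced by a separation probability and Fubini moves
  \<open>\<beta>\<close> outermost. For fixed \<open>\<beta>\<close> and \<open>w\<close>, two
  independent points lie on different sides of the hyperplane through \<open>w\<close> with
  probability F (1 - G) + G (1 - F), where F and G are the values of the projected distribution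
  functions.\<close>

lemma integral_ang_eq:
  fixes A B H :: "(real ^ 'n) measure"
  assumes A: "prob_space A" "sets A = sets borel" and B: "prob_space B" "sets B = sets borel"
    and H: "prob_space H" "sets H = sets borel" and diffuse: "\<And>x. emeasure H {x} = 0"
  shows "(\<integral>x. \<integral>y. \<integral>w. 1 / pi * ang (x - w) (y - w) \<partial>H \<partial>B \<partial>A) =
     (\<integral>\<beta>. \<integral>w. proj_cdf A \<beta> (\<beta> \<bullet> w) + proj_cdf B \<beta> (\<beta> \<bullet> w) -
        2 * (proj_cdf A \<beta> (\<beta> \<bullet> w) * proj_cdf B \<beta> (\<beta> \<bullet> w)) \<partial>H \<partial>direction_measure)"
    (is "_ = ?R")
    and "(\<lambda>(x, y). \<integral>w. 1 / pi * ang (x - w) (y - w) \<partial>H) \<in> borel_measurable (borel \<Otimes>\<^sub>M borel)"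
proof -
  have [measurable_cong]: "sets A = sets borel" "sets B = sets borel" "sets H = sets borel"
    by fact+
  interpret A: prob_space A by (rule A)
  interpret B: prob_space B by (rule B)
  interpret H: prob_space H by (rule H)
  interpret L: prob_space "direction_measure :: (real ^ 'n) measure"
    by (rule prob_space_direction_measure)
  interpret AB: pair_prob_space A B ..
  \<comment> \<open>\<open>s\<close> indicates that the hyperplane through \<open>w\<close> with
    normal \<open>\<beta>\<close> separates \<open>x\<close> and \<open>y\<close>; a point on it
    counts to the lower side.\<close>
  define s :: "real ^ 'n \<Rightarrow> real ^ 'n \<Rightarrow> real ^ 'n \<Rightarrow> real ^ 'n \<Rightarrow> real"
    where "s \<beta> w x y = of_bool ((\<beta> \<bullet> x \<le> \<beta> \<bullet> w) \<noteq> (\<beta> \<bullet> y \<le> \<beta> \<bullet> w))" for \<beta> w x y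
  have s_meas [measurable]: "(\<lambda>z. s (e z) (f z) (g z) (h z)) \<in> borel_measurable M"
    if [measurable]: "e \<in> borel_measurable M" "f \<in> borel_measurable M"
      "g \<in> borel_measurable M" "h \<in> borel_measurable M" for e f g h and M :: "'c measure"
    unfolding s_def by measurable
  have s_bound: "\<bar>s \<beta> w x y\<bar> \<le> 1" for \<beta> w x y
    by (simp add: s_def)
  have sep: "separation_prob (x - w) (y - w) = (\<integral>\<beta>. s \<beta> w x y \<partial>direction_measure)" for w x y
  proof -
    have "(\<lambda>\<beta>. s \<beta> w x y) = indicator {\<beta>. (\<beta> \<bullet> (x - w) \<le> 0) \<noteq> (\<beta> \<bullet> (y - w) \<le> 0)}"
      by (auto simp: s_def indicator_def inner_diff_right)
    then show ?thesis
      by (simp add: separation_prob_def)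
  qed
  have rho: "(\<integral>w. 1 / pi * ang (x - w) (y - w) \<partial>H) = (\<integral>w. \<integral>\<beta>. s \<beta> w x y \<partial>direction_measure \<partial>H)" for x y
  proof (rule integral_cong_AE)
    \<comment> \<open>At \<open>w = x\<close> or \<open>w = y\<close> the default value of
      \<open>ang\<close> need not match the separation probability; \<open>H\<close> has no atoms,
      so these \<open>w\<close> are negligible.\<close>
    have ne: "AE w in H. w \<noteq> x" for x
      by (rule AE_I[of _ _ "{x}"]) (auto simp: diffuse)
    show "AE w in H. 1 / pi * ang (x - w) (y - w) = (\<integral>\<beta>. s \<beta> w x y \<partial>direction_measure)"
      using ne[of x] ne[of y] by eventually_elim (simp add: ang_eq_separation_prob sep)
    show "(\<lambda>w. 1 / pi * ang (x - w) (y - w)) \<in> borel_measurable H"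
      unfolding ang_eq_separation_prob sep by measurable
  qed measurable
  show "(\<lambda>(x, y). \<integral>w. 1 / pi * ang (x - w) (y - w) \<partial>H) \<in> borel_measurable (borel \<Otimes>\<^sub>M borel)"
    unfolding rho by measurable
  have "(\<integral>x. \<integral>y. \<integral>w. 1 / pi * ang (x - w) (y - w) \<partial>H \<partial>B \<partial>A) =
      (\<integral>x. \<integral>y. \<integral>w. \<integral>\<beta>. s \<beta> w x y \<partial>direction_measure \<partial>H \<partial>B \<partial>A)"
    unfolding rho ..
  \<comment> \<open>The pair is bundled as one variable \<open>p\<close>, so that swaps of
    neighbouring integrals can move it innermost.\<close>
  also have "\<dots> = (\<integral>p. \<integral>w. \<integral>\<beta>. s \<beta> w (fst p) (snd p) \<partial>direction_measure \<partial>H \<partial>(A \<Otimes>\<^sub>M B))"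
  proof -
    have "integrable (A \<Otimes>\<^sub>M B) (\<lambda>(x, y). \<integral>w. \<integral>\<beta>. s \<beta> w x y \<partial>direction_measure \<partial>H)"
      by (rule integrable_prob_bounded[where C=1])
        (auto intro!: AB.prob_space_axioms abs_integral_prob_le H prob_space_direction_measure s_bound)
    from AB.integral_fst[OF this] show ?thesis
      by (simp add: case_prod_unfold)
  qed
  also have "\<dots> = (\<integral>p. \<integral>\<beta>. \<integral>w. s \<beta> w (fst p) (snd p) \<partial>H \<partial>direction_measure \<partial>(A \<Otimes>\<^sub>M B))"
    by (intro Bochner_Integration.integral_cong refl integral_swap_bounded[where C=1] s_bound H
        prob_space_direction_measure) measurable
  also have "\<dots> = (\<integral>\<beta>. \<integral>p. \<integral>w. s \<beta> w (fst p) (snd p) \<partial>H \<partial>(A \<Otimes>\<^sub>M B) \<partial>direction_measure)"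
    by (intro integral_swap_bounded[where C=1] AB.prob_space_axioms abs_integral_prob_le H
        prob_space_direction_measure s_bound) measurable
  also have "\<dots> = (\<integral>\<beta>. \<integral>w. \<integral>p. s \<beta> w (fst p) (snd p) \<partial>(A \<Otimes>\<^sub>M B) \<partial>H \<partial>direction_measure)"
    by (intro Bochner_Integration.integral_cong refl integral_swap_bounded[where C=1] s_bound H
        AB.prob_space_axioms) measurable
  also have "\<dots> = ?R"
  proof (intro Bochner_Integration.integral_cong refl)
    fix \<beta> w
    define i :: "real ^ 'n \<Rightarrow> real" where "i x = of_bool (\<beta> \<bullet> x \<le> \<beta> \<bullet> w)" for x
    have [measurable]: "i \<in> borel_measurable borel"
      unfolding i_def by measurable
    have iA: "integrable A i" and iB: "integrable B i"
      by (auto intro!: integrable_prob_bounded[where C=1] A B simp: i_def)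
    have FA: "(\<integral>x. i x \<partial>A) = proj_cdf A \<beta> (\<beta> \<bullet> w)" and FB: "(\<integral>x. i x \<partial>B) = proj_cdf B \<beta> (\<beta> \<bullet> w)"
      by (simp_all add: i_def proj_cdf_eq_integral A B)
    have "integrable (A \<Otimes>\<^sub>M B) (\<lambda>(x, y). s \<beta> w x y)"
      by (rule integrable_prob_bounded[where C=1]) (auto intro!: AB.prob_space_axioms s_bound)
    from AB.integral_fst[OF this]
    have "(\<integral>p. s \<beta> w (fst p) (snd p) \<partial>(A \<Otimes>\<^sub>M B)) = (\<integral>x. \<integral>y. s \<beta> w x y \<partial>B \<partial>A)"
      by (simp add: case_prod_unfold)
    \<comment> \<open>Exclusive or of 0-1 values is a polynomial in them, whose product term
      integrates factor by factor.\<close>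
    also have "\<dots> = (\<integral>x. \<integral>y. i x + i y - 2 * (i x * i y) \<partial>B \<partial>A)"
      by (intro Bochner_Integration.integral_cong refl) (auto simp: s_def i_def)
    also have "\<dots> = (\<integral>x. i x + proj_cdf B \<beta> (\<beta> \<bullet> w) - 2 * (i x * proj_cdf B \<beta> (\<beta> \<bullet> w)) \<partial>A)"
      using iB by (simp add: FB B.prob_space)
    also have "\<dots> = proj_cdf A \<beta> (\<beta> \<bullet> w) + proj_cdf B \<beta> (\<beta> \<bullet> w) -
        2 * (proj_cdf A \<beta> (\<beta> \<bullet> w) * proj_cdf B \<beta> (\<beta> \<bullet> w))"
      using iA by (simp add: FA A.prob_space)
    finally show "(\<integral>p. s \<beta> w (fst p) (snd p) \<partial>(A \<Otimes>\<^sub>M B)) =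
      proj_cdf A \<beta> (\<beta> \<bullet> w) + proj_cdf B \<beta> (\<beta> \<bullet> w) -
        2 * (proj_cdf A \<beta> (\<beta> \<bullet> w) * proj_cdf B \<beta> (\<beta> \<bullet> w))" .
  qed
  finally show "(\<integral>x. \<integral>y. \<integral>w. 1 / pi * ang (x - w) (y - w) \<partial>H \<partial>B \<partial>A) = ?R" .
qed

text \<open>The point lies in a fibre of \<open>x \<mapsto> \<beta> \<bullet> x\<close>, and that
  fibre is null because the distribution function has no jump.\<close>

lemma emeasure_singleton_eq_0_of_continuous_proj_cdf:
  fixes P :: "(real ^ 'n) measure"
  assumes P: "prob_space P" "sets P = sets borel" and cont: "continuous_on UNIV (proj_cdf P \<beta>)"
  shows "emeasure P {x} = 0"
proof -
  have [measurable_cong]: "sets P = sets borel" by fact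
  interpret P: prob_space P by (rule P)
  interpret D: real_distribution "distr P borel (\<lambda>x. \<beta> \<bullet> x)"
    by (rule real_distribution_projection[OF P])
  have "D.prob {\<beta> \<bullet> x} = 0"
    using cont by (simp add: D.isCont_cdf[symmetric] proj_cdf_def continuous_on_eq_continuous_at)
  then have "P.prob ((\<lambda>x. \<beta> \<bullet> x) -` {\<beta> \<bullet> x} \<inter> space P) = 0"
    by (subst (asm) measure_distr) auto
  moreover have "(\<bullet>) \<beta> -` {\<beta> \<bullet> x} \<in> sets borel"
    using measurable_sets[OF borel_measurable_inner_const, of "{\<beta> \<bullet> x}" \<beta>] by simp
  then have "P.prob {x} \<le> P.prob ((\<lambda>x. \<beta> \<bullet> x) -` {\<beta> \<bullet> x} \<inter> space P)"
    using sets_eq_imp_space_eq[OF P(2)] by (intro P.finite_measure_mono) auto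
  ultimately show ?thesis
    by (simp add: P.emeasure_eq_measure measure_le_0_iff)
qed

section \<open>Passage to random vectors and conclusion\<close>

lemma expectation_indep_pair:
  fixes f :: "'a::second_countable_topology \<Rightarrow> 'a \<Rightarrow> real"
  assumes M: "prob_space M" and indep: "prob_space.indep_var M borel X borel Y"
    and f: "case_prod f \<in> borel_measurable (borel \<Otimes>\<^sub>M borel)" and b: "\<And>x y. \<bar>f x y\<bar> \<le> C"
  shows "prob_space.expectation M (\<lambda>\<omega>. f (X \<omega>) (Y \<omega>)) =
    (\<integral>x. \<integral>y. f x y \<partial>distr M borel Y \<partial>distr M borel X)"
proof -
  interpret prob_space M by (rule M)
  have [measurable]: "X \<in> borel_measurable M" "Y \<in> borel_measurable M"
    and eq: "distr M borel X \<Otimes>\<^sub>M distr M borel Y = distr M (borel \<Otimes>\<^sub>M borel) (\<lambda>x. (X x, Y x))"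
    using indep by (auto simp: indep_var_distribution_eq)
  interpret A: prob_space "distr M borel X" by (rule prob_space_distr) simp
  interpret B: prob_space "distr M borel Y" by (rule prob_space_distr) simp
  interpret AB: pair_prob_space "distr M borel X" "distr M borel Y" ..
  have "integrable (distr M borel X \<Otimes>\<^sub>M distr M borel Y) (case_prod f)"
    by (rule integrable_prob_bounded[where C=C]) (use f b in \<open>auto intro!: AB.prob_space_axioms cong: measurable_cong_sets\<close>)
  from AB.integral_fst[OF this]
  have "(\<integral>x. \<integral>y. f x y \<partial>distr M borel Y \<partial>distr M borel X) =
      (\<integral>p. case_prod f p \<partial>distr M (borel \<Otimes>\<^sub>M borel) (\<lambda>x. (X x, Y x)))"
    by (simp add: eq)
  also have "\<dots> = expectation (\<lambda>\<omega>. f (X \<omega>) (Y \<omega>))"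
    using f by (subst integral_distr) auto
  finally show ?thesis ..
qed

theorem proposition6p1:
  fixes P\<^sub>X P\<^sub>Y :: "(real ^ 'n) measure"
    and M :: "'w measure"
    and X\<^sub>1 X\<^sub>2 Y\<^sub>1 Y\<^sub>2 :: "'w \<Rightarrow> real ^ 'n"
    and \<theta> :: real
  assumes "prob_space P\<^sub>X" and "sets P\<^sub>X = sets borel"
    and "prob_space P\<^sub>Y" and "sets P\<^sub>Y = sets borel"
    and "AE \<beta> in uniform_sphere.
           continuous_on UNIV (proj_cdf P\<^sub>X \<beta>) \<and> continuous_on UNIV (proj_cdf P\<^sub>Y \<beta>)"
    and "0 < \<theta>" and "\<theta> < 1"
    and "prob_space M"
    and "X\<^sub>1 \<in> borel_measurable M" and "distr M borel X\<^sub>1 = P\<^sub>X"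
    and "X\<^sub>2 \<in> borel_measurable M" and "distr M borel X\<^sub>2 = P\<^sub>X"
    and "Y\<^sub>1 \<in> borel_measurable M" and "distr M borel Y\<^sub>1 = P\<^sub>Y"
    and "Y\<^sub>2 \<in> borel_measurable M" and "distr M borel Y\<^sub>2 = P\<^sub>Y"
    and "prob_space.indep_var M borel X\<^sub>1 borel X\<^sub>2"
    and "prob_space.indep_var M borel Y\<^sub>1 borel Y\<^sub>2"
    and "prob_space.indep_var M
           (borel \<Otimes>\<^sub>M borel) (\<lambda>\<omega>. (X\<^sub>1 \<omega>, X\<^sub>2 \<omega>)) (borel \<Otimes>\<^sub>M borel) (\<lambda>\<omega>. (Y\<^sub>1 \<omega>, Y\<^sub>2 \<omega>))"
  shows "2 * cvm_dist_sq \<theta> P\<^sub>X P\<^sub>Y =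
           2 * prob_space.expectation M (\<lambda>\<omega>. rho_angle P\<^sub>X P\<^sub>Y (X\<^sub>1 \<omega>) (Y\<^sub>1 \<omega>))
             - prob_space.expectation M (\<lambda>\<omega>. rho_angle P\<^sub>X P\<^sub>Y (X\<^sub>1 \<omega>) (X\<^sub>2 \<omega>))
             - prob_space.expectation M (\<lambda>\<omega>. rho_angle P\<^sub>X P\<^sub>Y (Y\<^sub>1 \<omega>) (Y\<^sub>2 \<omega>))"
proof -
  note P = assms(1,2) and Q = assms(3,4) and cont = assms(5) and M = assms(8)
  have \<theta>: "0 \<le> \<theta>" "\<theta> \<le> 1"
    using assms(6,7) by auto
  interpret M: prob_space M by (rule M)
  define H where "H = half_mixture P\<^sub>X P\<^sub>Y"
  have H: "prob_space H" "sets H = sets borel"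
    unfolding H_def half_mixture_eq_mixture[OF P Q]
    by (rule prob_space_mixture[OF P Q] sets_mixture[OF P Q])+
  \<comment> \<open>What holds almost surely under a probability measure holds somewhere, and one
    direction with continuous projections excludes atoms of both laws.\<close>
  obtain \<beta>0 where "continuous_on UNIV (proj_cdf P\<^sub>X \<beta>0)" "continuous_on UNIV (proj_cdf P\<^sub>Y \<beta>0)"
    using eventually_happens'[OF prob_space.ae_filter_bot[OF prob_space_uniform_sphere] cont] by blast
  then have diffuse: "emeasure H {x} = 0" for x
    unfolding H_def using P Q
    by (simp add: emeasure_half_mixture emeasure_singleton_eq_0_of_continuous_proj_cdf[of _ \<beta>0])
  have rho: "rho_angle P\<^sub>X P\<^sub>Y x y = (\<integral>w. 1 / pi * ang (x - w) (y - w) \<partial>H)" for x y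
    by (simp add: rho_angle_def H_def)
  \<comment> \<open>The scaled angle is either a probability or the default value 1/2.\<close>
  have ang_bound: "\<bar>1 / pi * ang u v\<bar> \<le> 1" for u v :: "real ^ 'n"
    using prob_space.prob_le_1[OF prob_space_direction_measure]
    by (auto simp: ang_eq_separation_prob separation_prob_def)
  have rho_bound: "\<bar>rho_angle P\<^sub>X P\<^sub>Y x y\<bar> \<le> 1" for x y
    unfolding rho by (intro abs_integral_prob_le H ang_bound)
  have rho_meas: "case_prod (rho_angle P\<^sub>X P\<^sub>Y) \<in> borel_measurable (borel \<Otimes>\<^sub>M borel)"
    using integral_ang_eq(2)[OF P Q H diffuse] by (simp only: rho[symmetric])
  have indep: "M.indep_var borel X\<^sub>1 borel Y\<^sub>1"
    using M.indep_var_compose[OF assms(19) measurable_fst measurable_fst] by (simp add: comp_def)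
  \<comment> \<open>\<open>E\<close> passes from random vectors to their laws and \<open>S\<close>
    from there to projected distribution functions; the three expectations differ only in the laws
    inserted.\<close>
  note E = expectation_indep_pair[OF M _ rho_meas rho_bound]
  note S = integral_ang_eq(1)[OF _ _ _ _ H diffuse, folded rho]
  let ?F = "\<lambda>\<beta> w. proj_cdf P\<^sub>X \<beta> (\<beta> \<bullet> w)" and ?G = "\<lambda>\<beta> w. proj_cdf P\<^sub>Y \<beta> (\<beta> \<bullet> w)"
  let ?I = "\<lambda>f. \<integral>\<beta>. \<integral>w. f \<beta> w \<partial>H \<partial>direction_measure"
  have XY: "M.expectation (\<lambda>\<omega>. rho_angle P\<^sub>X P\<^sub>Y (X\<^sub>1 \<omega>) (Y\<^sub>1 \<omega>)) =
      ?I (\<lambda>\<beta> w. ?F \<beta> w + ?G \<beta> w - 2 * (?F \<beta> w * ?G \<beta> w))"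
    using E[OF indep] S[OF P Q] assms(10,14) by simp
  have XX: "M.expectation (\<lambda>\<omega>. rho_angle P\<^sub>X P\<^sub>Y (X\<^sub>1 \<omega>) (X\<^sub>2 \<omega>)) =
      ?I (\<lambda>\<beta> w. ?F \<beta> w + ?F \<beta> w - 2 * (?F \<beta> w * ?F \<beta> w))"
    using E[OF assms(17)] S[OF P P] assms(10,12) by simp
  have YY: "M.expectation (\<lambda>\<omega>. rho_angle P\<^sub>X P\<^sub>Y (Y\<^sub>1 \<omega>) (Y\<^sub>2 \<omega>)) =
      ?I (\<lambda>\<beta> w. ?G \<beta> w + ?G \<beta> w - 2 * (?G \<beta> w * ?G \<beta> w))"
    using E[OF assms(18)] S[OF Q Q] assms(14,16) by simp
  have cvm: "cvm_dist_sq \<theta> P\<^sub>X P\<^sub>Y = ?I (\<lambda>\<beta> w. (?F \<beta> w - ?G \<beta> w)\<^sup>2)"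
    unfolding H_def by (rule cvm_dist_sq_eq_integral_half_mixture[OF P Q cont \<theta>])
  interpret H: prob_space H by (rule H)
  note [measurable_cong] = H(2)
  note [measurable] = measurable_proj_cdf[OF P] measurable_proj_cdf[OF Q]
  have I: "integrable H (\<lambda>w. f \<beta> w)" "integrable direction_measure (\<lambda>\<beta>. \<integral>w. f \<beta> w \<partial>H)"
    if [measurable]: "case_prod f \<in> borel_measurable (borel \<Otimes>\<^sub>M borel)" and b: "\<And>x y. \<bar>f x y\<bar> \<le> 1"
    for f :: "real ^ 'n \<Rightarrow> real ^ 'n \<Rightarrow> real" and \<beta>
    by (auto intro!: integrable_prob_bounded[where C=1] abs_integral_prob_le
        H prob_space_direction_measure b)
  note bounds = proj_cdf_bounds[OF P] proj_cdf_bounds[OF Q]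
  \<comment> \<open>Integrability of \<open>?F\<close>, \<open>?G\<close> and their products in both
    layers of the double integral lets linearity split \<open>?I\<close>.\<close>
  have J: "integrable H (f \<beta>)" "integrable direction_measure (\<lambda>\<beta>. \<integral>w. f \<beta> w \<partial>H)"
      "integrable H (\<lambda>w. f \<beta> w * g \<beta> w)" "integrable direction_measure (\<lambda>\<beta>. \<integral>w. f \<beta> w * g \<beta> w \<partial>H)"
    if "f \<in> {?F, ?G}" "g \<in> {?F, ?G}" for f g \<beta>
  proof -
    have [measurable]: "case_prod f \<in> borel_measurable (borel \<Otimes>\<^sub>M borel)"
        "case_prod g \<in> borel_measurable (borel \<Otimes>\<^sub>M borel)"
      using that by auto
    have b: "0 \<le> f x y" "f x y \<le> 1" "0 \<le> g x y" "g x y \<le> 1" for x y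
      using that bounds by auto
    have fg: "\<bar>f x y * g x y\<bar> \<le> 1" for x y
      using b[of x y] by (simp add: abs_mult mult_le_one)
    show "integrable H (f \<beta>)" "integrable direction_measure (\<lambda>\<beta>. \<integral>w. f \<beta> w \<partial>H)"
      "integrable H (\<lambda>w. f \<beta> w * g \<beta> w)" "integrable direction_measure (\<lambda>\<beta>. \<integral>w. f \<beta> w * g \<beta> w \<partial>H)"
      by (intro I; use b fg in simp)+
  qed
  have F: "?F \<in> {?F, ?G}" and G: "?G \<in> {?F, ?G}"
    by simp_all
  note J = J[OF F F] J[OF F G] J[OF G G]
  have "?I (\<lambda>\<beta> w. (?F \<beta> w - ?G \<beta> w)\<^sup>2) =
      ?I (\<lambda>\<beta> w. ?F \<beta> w * ?F \<beta> w) - 2 * ?I (\<lambda>\<beta> w. ?F \<beta> w * ?G \<beta> w) + ?I (\<lambda>\<beta> w. ?G \<beta> w * ?G \<beta> w)"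
  proof -
    have "(?F \<beta> w - ?G \<beta> w)\<^sup>2 = ?F \<beta> w * ?F \<beta> w - 2 * (?F \<beta> w * ?G \<beta> w) + ?G \<beta> w * ?G \<beta> w" for \<beta> w
      by (simp add: power2_eq_square algebra_simps)
    then show ?thesis
      using J by simp
  qed
  \<comment> \<open>Both sides are now linear combinations of integrals of F, G, F^2, FG and G^2, in
    which the terms in F and G cancel.\<close>
  then show ?thesis
    unfolding XY XX YY cvm using J by simp
qed

end
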